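(* Let $a=\{a_n\}_{n\ge 0}$ be a sequence of complex numbers and let $T_a:L^2[0,1]\to L^2[0,1]$ be a bounded Walsh multiplier with symbol $a$. Then $$\sigma(T_a)=\overline{\{a_n:\ n\ge 0\}}.$$ Moreover, $\lambda\in\mathbb{C}$ belongs to the resolvent set $\rho(T_a)$ if and only if $\inf_{n\ge0}|a_n-\lambda|>0$, and in this case $$\|(T_a-\lambda I)^{-1}\|_{L^2\to L^2}=\sup_{n\ge0}\frac{1}{|a_n-\lambda|}.$$
   Context: All function spaces consist of complex-valued functions on $[0,1]$ with Lebesgue measure. For $k\in\mathbb{N}_0=\{0,1,2,\dots\}$ the Rademacher functions are $r_k(x)=\operatorname{sign}(\sin(2^{k+1}\pi x))$, $x\in[0,1)$. If $n=\sum_{k=0}^m b_k2^k$ with $b_k\in\{0,1\}$ is the dyadic expansion of $n\in\mathbb{N}_0$, the Walsh(-Paley) function is $W_n(x)=\prod_{k=0}^m r_k(x)^{b_k}$ (with $W_0=1$). The Walsh functions take values $\pm1$ a.e. and form an orthonormal basis of $L^2[0,1]$. For $f\in L^1[0,1]$ the Walsh-Fourier coefficients are $\hat f(n)=\int_0^1 f(x)W_n(x)\,dx$, $n\in\mathbb{N}_0$. The Walsh multiplier operator with symbol $a=\{a_n\}_{n\ge0}$ is given by $T_af=\sum_{n=0}^\infty a_n\hat f(n)W_n$. That $T_a:L^2[0,1]\to L^2[0,1]$ is a bounded Walsh multiplier means that this formula defines a bounded linear operator on $L^2[0,1]$ (equivalently, $T_a$ is the bounded linear operator on $L^2[0,1]$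 with $T_aW_n=a_nW_n$ for all $n$). $\sigma(T_a)$ and $\rho(T_a)=\mathbb{C}\setminus\sigma(T_a)$ denote the spectrum and resolvent set of $T_a$ as a bounded operator on $L^2[0,1]$, and the bar denotes closure in $\mathbb{C}$. *)

theory Defs
  imports "HOL-Analysis.Analysis"
begin

section \<open>The Hilbert space of square-integrable functions on the unit interval\<close>

abbreviation unit_lebesgue :: "real measure"
  where "unit_lebesgue \<equiv> lebesgue_on {0..1}"

definition square_integrable :: "(real \<Rightarrow> complex) \<Rightarrow> bool" where
  "square_integrable f \<longleftrightarrow>
     f \<in> borel_measurable unit_lebesgue \<and> integrable unit_lebesgue (\<lambda>x. (cmod (f x))\<^sup>2)"

definition L2_rel :: "(real \<Rightarrow> complex) \<Rightarrow> (real \<Rightarrow> complex) \<Rightarrow> bool" where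
  "L2_rel f g \<longleftrightarrow>
     square_integrable f \<and> square_integrable g \<and> (AE x in unit_lebesgue. f x = g x)"

lemma square_integrable_measurable [measurable_dest]:
  "square_integrable f \<Longrightarrow> f \<in> borel_measurable unit_lebesgue"
  by (simp add: square_integrable_def)

lemma square_integrable_bounded:
  assumes [measurable]: "f \<in> borel_measurable unit_lebesgue" and "\<And>x. cmod (f x) \<le> B"
  shows "square_integrable f"
proof -
  have "finite_measure unit_lebesgue"
    by (rule finite_measure_lebesgue_on) auto
  moreover have "(cmod (f x))\<^sup>2 \<le> B\<^sup>2" for x
    using assms(2) by (intro power_mono) auto
  ultimately have "integrable unit_lebesgue (\<lambda>x. (cmod (f x))\<^sup>2)"
    by (intro finite_measure.integrable_const_bound[where B = "B\<^sup>2"]) auto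
  then show ?thesis
    by (simp add: square_integrable_def)
qed

lemma square_integrable_zero: "square_integrable (\<lambda>x. 0)"
  by (simp add: square_integrable_def)

lemma square_integrable_mult:
  assumes "square_integrable f"
  shows "square_integrable (\<lambda>x. c * f x)"
  using assms by (auto simp: square_integrable_def norm_mult power_mult_distrib)

lemma square_integrable_add:
  assumes "square_integrable f" "square_integrable g"
  shows "square_integrable (\<lambda>x. f x + g x)"
proof -
  have [measurable]: "f \<in> borel_measurable unit_lebesgue" "g \<in> borel_measurable unit_lebesgue"
    using assms by (auto simp: square_integrable_def)
  have le: "(cmod (f x + g x))\<^sup>2 \<le> 2 * (cmod (f x))\<^sup>2 + 2 * (cmod (g x))\<^sup>2" for x
  proof -
    have "(cmod (f x + g x))\<^sup>2 \<le> (cmod (f x) + cmod (g x))\<^sup>2"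
      by (intro power_mono norm_triangle_ineq) auto
    also have "\<dots> \<le> 2 * (cmod (f x))\<^sup>2 + 2 * (cmod (g x))\<^sup>2"
      using zero_le_power2[of "cmod (f x) - cmod (g x)"]
      by (simp add: power2_eq_square algebra_simps)
    finally show ?thesis .
  qed
  have "integrable unit_lebesgue (\<lambda>x. (cmod (f x + g x))\<^sup>2)"
    by (rule Bochner_Integration.integrable_bound
          [where f = "\<lambda>x. 2 * (cmod (f x))\<^sup>2 + 2 * (cmod (g x))\<^sup>2"])
      (use assms le in \<open>auto simp: square_integrable_def\<close>)
  then show ?thesis
    by (simp add: square_integrable_def)
qed

lemma square_integrable_minus:
  assumes "square_integrable f"
  shows "square_integrable (\<lambda>x. - f x)"
  using square_integrable_mult[OF assms, of "-1"] by simp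

lemma square_integrable_diff:
  assumes "square_integrable f" "square_integrable g"
  shows "square_integrable (\<lambda>x. f x - g x)"
  using square_integrable_add[OF assms(1) square_integrable_minus[OF assms(2)]] by simp

lemma integrable_mult_square_integrable:
  assumes "square_integrable f" "square_integrable g"
  shows "integrable unit_lebesgue (\<lambda>x. f x * g x)"
proof -
  have [measurable]: "f \<in> borel_measurable unit_lebesgue" "g \<in> borel_measurable unit_lebesgue"
    using assms by (auto simp: square_integrable_def)
  have le: "cmod (f x * g x) \<le> (cmod (f x))\<^sup>2 + (cmod (g x))\<^sup>2" for x
  proof -
    have "0 \<le> (cmod (f x) - cmod (g x))\<^sup>2" "0 \<le> cmod (f x) * cmod (g x)"
      by simp_all
    then show ?thesis
      unfolding norm_mult power2_diff by linarith
  qed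
  show ?thesis
    by (rule Bochner_Integration.integrable_bound
          [where f = "\<lambda>x. (cmod (f x))\<^sup>2 + (cmod (g x))\<^sup>2"])
      (use assms le in \<open>auto simp: square_integrable_def\<close>)
qed

lemma integrable_inner_square_integrable:
  assumes "square_integrable f" "square_integrable g"
  shows "integrable unit_lebesgue (\<lambda>x. f x \<bullet> g x)"
proof -
  have "square_integrable (\<lambda>x. cnj (g x))"
    using assms(2) borel_measurable_continuous_on[of cnj g unit_lebesgue]
    by (auto simp: square_integrable_def intro: continuous_intros)
  then have "integrable unit_lebesgue (\<lambda>x. Re (f x * cnj (g x)))"
    using assms(1) by (intro integrable_Re integrable_mult_square_integrable)
  then show ?thesis
    by (simp add: inner_complex_def)
qed

quotient_type L2 = "real \<Rightarrow> complex" / partial: L2_rel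
proof (rule part_equivpI)
  show "\<exists>f. L2_rel f f"
    using square_integrable_zero by (auto simp: L2_rel_def)
  show "symp L2_rel"
    by (rule sympI) (auto simp: L2_rel_def)
  show "transp L2_rel"
    by (rule transpI) (auto simp: L2_rel_def)
qed

lift_definition scaleC :: "complex \<Rightarrow> L2 \<Rightarrow> L2"  (infixr \<open>*\<^sub>C\<close> 75)
  is "\<lambda>c f x. c * f x"
  by (auto simp: L2_rel_def square_integrable_mult)

text \<open>
  The \<^class>\<open>real_inner\<close> structure is the one underlying the complex Hilbert space:
  the inner product is the real part of the Hermitian one.
\<close>

instantiation L2 :: real_inner
begin

lift_definition zero_L2 :: L2 is "\<lambda>x. 0"
  by (simp add: L2_rel_def square_integrable_zero)

lift_definition plus_L2 :: "L2 \<Rightarrow> L2 \<Rightarrow> L2" is "\<lambda>f g x. f x + g x"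
  by (auto simp: L2_rel_def square_integrable_add)

lift_definition minus_L2 :: "L2 \<Rightarrow> L2 \<Rightarrow> L2" is "\<lambda>f g x. f x - g x"
  by (auto simp: L2_rel_def square_integrable_diff)

lift_definition uminus_L2 :: "L2 \<Rightarrow> L2" is "\<lambda>f x. - f x"
  by (auto simp: L2_rel_def square_integrable_minus)

lift_definition scaleR_L2 :: "real \<Rightarrow> L2 \<Rightarrow> L2" is "\<lambda>r f x. complex_of_real r * f x"
  by (auto simp: L2_rel_def square_integrable_mult)

lift_definition inner_L2 :: "L2 \<Rightarrow> L2 \<Rightarrow> real" is "\<lambda>f g. LINT x|unit_lebesgue. f x \<bullet> g x"
proof -
  fix f f' g g' assume *: "L2_rel f f'" "L2_rel g g'"
  then have [measurable]:
    "f \<in> borel_measurable unit_lebesgue" "f' \<in> borel_measurable unit_lebesgue"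
    "g \<in> borel_measurable unit_lebesgue" "g' \<in> borel_measurable unit_lebesgue"
    by (auto simp: L2_rel_def square_integrable_def)
  show "(LINT x|unit_lebesgue. f x \<bullet> g x) = (LINT x|unit_lebesgue. f' x \<bullet> g' x)"
    by (rule integral_cong_AE) (use * in \<open>auto simp: L2_rel_def\<close>)
qed

lift_definition norm_L2 :: "L2 \<Rightarrow> real"
  is "\<lambda>f. sqrt (LINT x|unit_lebesgue. (cmod (f x))\<^sup>2)"
proof -
  fix f f' assume *: "L2_rel f f'"
  then have [measurable]:
    "f \<in> borel_measurable unit_lebesgue" "f' \<in> borel_measurable unit_lebesgue"
    by (auto simp: L2_rel_def square_integrable_def)
  have "(LINT x|unit_lebesgue. (cmod (f x))\<^sup>2) = (LINT x|unit_lebesgue. (cmod (f' x))\<^sup>2)"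
    by (rule integral_cong_AE) (use * in \<open>auto simp: L2_rel_def\<close>)
  then show "sqrt (LINT x|unit_lebesgue. (cmod (f x))\<^sup>2) = sqrt (LINT x|unit_lebesgue. (cmod (f' x))\<^sup>2)"
    by simp
qed

definition dist_L2 :: "L2 \<Rightarrow> L2 \<Rightarrow> real" where
  "dist_L2 f g = norm (f - g)"

definition sgn_L2 :: "L2 \<Rightarrow> L2" where
  "sgn_L2 f = inverse (norm f) *\<^sub>R f"

definition uniformity_L2 :: "(L2 \<times> L2) filter" where
  "uniformity_L2 = (INF e\<in>{0<..}. principal {(f, g). dist f g < e})"

definition open_L2 :: "L2 set \<Rightarrow> bool" where
  "open_L2 U \<longleftrightarrow> (\<forall>f\<in>U. eventually (\<lambda>(f', g). f' = f \<longrightarrow> g \<in> U) uniformity)"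

instance
proof
  fix f g h :: L2 and r s :: real and U :: "L2 set"
  show "f + g + h = f + (g + h)"
    by transfer (auto simp: L2_rel_def algebra_simps intro!: square_integrable_add)
  show "f + g = g + f"
    by transfer (auto simp: L2_rel_def algebra_simps intro!: square_integrable_add)
  show "0 + f = f"
    by transfer (auto simp: L2_rel_def)
  show "- f + f = 0"
    by transfer (auto simp: L2_rel_def square_integrable_zero)
  show "f - g = f + - g"
    by transfer (auto simp: L2_rel_def intro!: square_integrable_diff)
  show "r *\<^sub>R (f + g) = r *\<^sub>R f + r *\<^sub>R g"
    by transfer (auto simp: L2_rel_def distrib_left
                      intro!: square_integrable_add square_integrable_mult)
  show "(r + s) *\<^sub>R f = r *\<^sub>R f + s *\<^sub>R f"
    by transfer (auto simp: L2_rel_def distrib_right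
                      intro!: square_integrable_add square_integrable_mult)
  show "r *\<^sub>R s *\<^sub>R f = (r * s) *\<^sub>R f"
    by transfer (auto simp: L2_rel_def mult.assoc intro!: square_integrable_mult)
  show "1 *\<^sub>R f = f"
    by transfer (auto simp: L2_rel_def)
  show "dist f g = norm (f - g)"
    by (rule dist_L2_def)
  show "sgn f = inverse (norm f) *\<^sub>R f"
    by (rule sgn_L2_def)
  show "(uniformity :: (L2 \<times> L2) filter) = (INF e\<in>{0<..}. principal {(x, y). dist x y < e})"
    by (rule uniformity_L2_def)
  show "open U \<longleftrightarrow> (\<forall>x\<in>U. \<forall>\<^sub>F (x', y) in uniformity. x' = x \<longrightarrow> y \<in> U)"
    by (rule open_L2_def)
  show "f \<bullet> g = g \<bullet> f"
    by transfer (simp add: inner_commute)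
  show "(f + g) \<bullet> h = f \<bullet> h + g \<bullet> h"
  proof transfer
    fix f g h assume "L2_rel f f" "L2_rel g g" "L2_rel h h"
    then show "(LINT x|unit_lebesgue. (f x + g x) \<bullet> h x)
        = (LINT x|unit_lebesgue. f x \<bullet> h x) + (LINT x|unit_lebesgue. g x \<bullet> h x)"
      unfolding inner_add_left
      by (intro Bochner_Integration.integral_add integrable_inner_square_integrable)
        (auto simp: L2_rel_def)
  qed
  show "r *\<^sub>R f \<bullet> g = r * (f \<bullet> g)"
  proof transfer
    fix r :: real and f g :: "real \<Rightarrow> complex"
    have "(complex_of_real r * f x) \<bullet> g x = r * (f x \<bullet> g x)" for x
      using inner_scaleR_left[of r "f x" "g x"] by (simp add: scaleR_conv_of_real)
    then show "(LINT x|unit_lebesgue. (complex_of_real r * f x) \<bullet> g x)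
        = r * (LINT x|unit_lebesgue. f x \<bullet> g x)"
      by simp
  qed
  show "0 \<le> f \<bullet> f"
    by transfer (auto intro!: integral_nonneg_AE)
  show "f \<bullet> f = 0 \<longleftrightarrow> f = 0"
  proof transfer
    fix f assume *: "L2_rel f f"
    then have "integrable unit_lebesgue (\<lambda>x. f x \<bullet> f x)"
      by (intro integrable_inner_square_integrable) (auto simp: L2_rel_def)
    then have "(LINT x|unit_lebesgue. f x \<bullet> f x) = 0 \<longleftrightarrow> (AE x in unit_lebesgue. f x \<bullet> f x = 0)"
      by (intro integral_nonneg_eq_0_iff_AE) auto
    also have "\<dots> \<longleftrightarrow> L2_rel f (\<lambda>x. 0)"
      using * by (auto simp: L2_rel_def square_integrable_zero)
    finally show "(LINT x|unit_lebesgue. f x \<bullet> f x) = 0 \<longleftrightarrow> L2_rel f (\<lambda>x. 0)" .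
  qed
  show "norm f = sqrt (f \<bullet> f)"
    by transfer (simp add: power2_norm_eq_inner)
qed

end


section \<open>Walsh functions and Walsh multipliers\<close>

definition rademacher :: "nat \<Rightarrow> real \<Rightarrow> real" where
  "rademacher k x = sgn (sin (2 ^ (k + 1) * pi * x))"

text \<open>
  \<open>n div 2 ^ k mod 2\<close> is the \<open>k\<close>-th dyadic digit of \<open>n\<close>. All digits beyond
  position \<open>n\<close> vanish, so the product may be cut off there.
\<close>

definition walsh :: "nat \<Rightarrow> real \<Rightarrow> real" where
  "walsh n x = (\<Prod>k\<le>n. rademacher k x ^ (n div 2 ^ k mod 2))"

lemma walsh_measurable [measurable]: "walsh n \<in> borel_measurable unit_lebesgue"
proof -
  have "rademacher k \<in> borel_measurable borel" for k
  proof -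
    have [measurable]: "(\<lambda>x::real. sin (2 ^ (k + 1) * pi * x)) \<in> borel_measurable borel"
      by (intro borel_measurable_continuous_onI continuous_intros)
    show ?thesis
      unfolding rademacher_def[abs_def] sgn_real_def by measurable
  qed
  then have "walsh n \<in> borel_measurable borel"
    unfolding walsh_def[abs_def] by measurable
  then have "walsh n \<in> borel_measurable lebesgue"
    by (intro measurable_completion) simp
  then show ?thesis
    by (rule measurable_restrict_space1)
qed

lemma abs_walsh_le_1: "\<bar>walsh n x\<bar> \<le> 1"
proof -
  have "\<bar>rademacher k x\<bar> \<le> 1" for k
    by (simp add: rademacher_def sgn_real_def)
  then show ?thesis
    unfolding walsh_def abs_prod power_abs
    by (intro prod_le_1) (auto intro!: power_le_one)
qed

lemma square_integrable_walsh: "square_integrable (\<lambda>x. complex_of_real (walsh n x))"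
  by (rule square_integrable_bounded[where B = 1]) (auto simp: abs_walsh_le_1)

lift_definition walsh_L2 :: "nat \<Rightarrow> L2" is "\<lambda>n x. complex_of_real (walsh n x)"
  by (simp add: L2_rel_def square_integrable_walsh)

lift_definition walsh_coeff :: "L2 \<Rightarrow> nat \<Rightarrow> complex"
  is "\<lambda>f n. LINT x|unit_lebesgue. f x * complex_of_real (walsh n x)"
proof
  fix f f' n assume *: "L2_rel f f'"
  then have [measurable]:
    "f \<in> borel_measurable unit_lebesgue" "f' \<in> borel_measurable unit_lebesgue"
    by (auto simp: L2_rel_def square_integrable_def)
  show "(LINT x|unit_lebesgue. f x * complex_of_real (walsh n x))
      = (LINT x|unit_lebesgue. f' x * complex_of_real (walsh n x))"
    by (rule integral_cong_AE) (use * in \<open>auto simp: L2_rel_def\<close>)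
qed

definition bounded_clinear :: "(L2 \<Rightarrow> L2) \<Rightarrow> bool" where
  "bounded_clinear T \<longleftrightarrow> bounded_linear T \<and> (\<forall>c f. T (c *\<^sub>C f) = c *\<^sub>C T f)"

definition walsh_multiplier :: "(nat \<Rightarrow> complex) \<Rightarrow> L2 \<Rightarrow> L2" where
  "walsh_multiplier a f = (\<Sum>n. (a n * walsh_coeff f n) *\<^sub>C walsh_L2 n)"

text \<open>
  Convergence of the defining series (in the norm of \<^typ>\<open>L2\<close>) has to be demanded explicitly,
  since \<^const>\<open>suminf\<close> has an unspecified value on divergent series.
\<close>

definition bounded_walsh_multiplier :: "(nat \<Rightarrow> complex) \<Rightarrow> bool" where
  "bounded_walsh_multiplier a \<longleftrightarrow>
     (\<forall>f. summable (\<lambda>n. (a n * walsh_coeff f n) *\<^sub>C walsh_L2 n)) \<and>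
     bounded_clinear (walsh_multiplier a)"

definition resolvent_set :: "(L2 \<Rightarrow> L2) \<Rightarrow> complex set" where
  "resolvent_set T =
     {z. \<exists>S. bounded_clinear S \<and>
             (\<forall>f. S (T f - z *\<^sub>C f) = f) \<and> (\<forall>f. T (S f) - z *\<^sub>C S f = f)}"

definition spectrum :: "(L2 \<Rightarrow> L2) \<Rightarrow> complex set" where
  "spectrum T = - resolvent_set T"

end

theory Submission
  imports Defs
begin

text \<open>
  The Walsh functions are an orthonormal basis of \<open>L2\<close>, so that taking Walsh coefficients
  identifies \<open>L2\<close> isometrically with the square summable sequences, and the multiplier with symbol \<open>a\<close>
  becomes the diagonal operator \<open>(c n) \<mapsto> (a n * c n)\<close>. For a diagonal operator everything is explicit. If
  \<open>\<bar>a n - z\<bar> \<ge> B > 0\<close> for all \<open>n\<close>, then the multiplier with symbol \<open>1 / (a n - z)\<close> is bounded by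
  \<open>1 / B\<close> and inverts \<open>T - z\<close> (\<open>resolvent_walsh_multiplier\<close>); its norm is the supremum of the moduli of its
  symbol (\<open>onorm_walsh_multiplier\<close>). Conversely, a bounded inverse of \<open>T - z\<close> maps the eigenvector
  \<open>walsh_L2 n\<close> to its multiple by \<open>1 / (a n - z)\<close>, which forces such a bound \<open>B\<close>. Finally, the distances
  \<open>\<bar>a n - z\<bar>\<close> stay away from zero precisely when \<open>z\<close> is not in the closure of the range of \<open>a\<close>.

  The work lies in the identification with sequences, which rests on three facts.

  \<^item> Orthonormality (\<open>integral_walsh_mult\<close>): the product of two Walsh functions is almost everywhere again a Walsh
    function, and a nonconstant Walsh function changes sign under a suitable translation, hence has integral zero.

  \<^item> Totality (\<open>AE_zero_if_walsh_coefficients_zero\<close>): indicators of dyadic intervals are almost everywhere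
    linear combinations of Walsh functions, so a function whose coefficients all vanish has
    integral zero over every dyadic interval, then over every half-line by continuity, and then over every
    measurable set.

  \<^item> Completeness of \<open>L2\<close>, proved by the classical argument of Riesz and Fischer. It is what guarantees that the
    series defining the inverse converges, in other words that every square summable sequence is a sequence
    of coefficients.

  Together they give Parseval's identity (\<open>Parseval_walsh\<close>).
\<close>

section \<open>Orthonormality of the Walsh functions\<close>

text \<open>
  With a cut-off \<open>N\<close> independent of \<open>n\<close>, products of several Walsh functions can be formed factor by factor.
\<close>

lemma walsh_eq_prod_bits:
  assumes "n < N"
  shows "walsh n x = (\<Prod>k<N. if bit n k then rademacher k x else 1)"
proof -
  have digit: "rademacher k x ^ (n div 2 ^ k mod 2) = (if bit n k then rademacher k x else 1)" for k
    by (simp add: bit_iff_odd mod_2_eq_odd)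
  have "walsh n x = (\<Prod>k\<le>n. if bit n k then rademacher k x else 1)"
    by (simp add: walsh_def digit)
  also have "\<dots> = (\<Prod>k<N. if bit n k then rademacher k x else 1)"
  proof (intro prod.mono_neutral_left ballI)
    fix k assume "k \<in> {..<N} - {..n}"
    then have "n < 2 ^ k"
      by (intro less_trans[OF _ less_exp]) auto
    then show "(if bit n k then rademacher k x else 1) = 1"
      by (simp add: bit_iff_odd)
  qed (use assms in auto)
  finally show ?thesis .
qed

lemma walsh_0 [simp]: "walsh 0 x = 1"
  by (simp add: walsh_def)

text \<open>
  Since bit \<open>k\<close> of \<open>n\<close> is clear, adding \<open>2 ^ k\<close> produces no carry and merely switches that bit on.
\<close>

lemma walsh_add_power:
  assumes "\<not> bit n k"
  shows "walsh (n + 2 ^ k) x = rademacher k x * walsh n x"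
proof -
  have N: "n < Suc (n + 2 ^ k)" "n + 2 ^ k < Suc (n + 2 ^ k)" "k < Suc (n + 2 ^ k)"
    using trans_le_add2[OF less_imp_le[OF less_exp[of k]], of n] by auto
  have bits: "bit (n + 2 ^ k) i \<longleftrightarrow> i = k \<or> bit n i" for i
  proof -
    have "n + 2 ^ k = set_bit k n"
      using assms by (simp add: set_bit_eq)
    then show ?thesis
      by (auto simp: bit_set_bit_iff)
  qed
  have "walsh (n + 2 ^ k) x =
      (\<Prod>i<Suc (n + 2 ^ k). (if i = k then rademacher k x else 1) * (if bit n i then rademacher i x else 1))"
    unfolding walsh_eq_prod_bits[OF N(2)] using assms by (intro prod.cong) (auto simp: bits)
  also have "\<dots> = rademacher k x * walsh n x"
    unfolding prod.distrib walsh_eq_prod_bits[OF N(1), symmetric] using N(3)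
    by (simp add: prod.delta)
  finally show ?thesis .
qed

text \<open>
  A Rademacher function vanishes only at dyadic rationals, of which there are countably many. Off this
  null set every \<open>rademacher k\<close> is \<open>\<plusminus>1\<close>, so that the pointwise identities for
  characters of the dyadic group become available.
\<close>

lemma AE_rademacher_nonzero: "AE x in unit_lebesgue. \<forall>k. rademacher k x \<noteq> 0"
proof -
  have "AE x in unit_lebesgue. rademacher k x \<noteq> 0" for k
  proof -
    have "rademacher k x = 0 \<Longrightarrow> x \<in> range (\<lambda>i::int. of_int i / 2 ^ (k + 1))" for x
      by (auto simp: rademacher_def sgn_eq_0_iff sin_zero_iff_int2 field_simps)
    then have "{x. rademacher k x = 0} \<subseteq> range (\<lambda>i::int. of_int i / 2 ^ (k + 1))"
      by auto
    then have "countable {x. rademacher k x = 0}"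
      by (rule countable_subset) auto
    then have "{x. rademacher k x = 0} \<in> null_sets lebesgue"
      by (intro null_sets_completionI countable_imp_null_set_lborel)
    then have "AE x in lebesgue. rademacher k x \<noteq> 0"
      using AE_not_in by force
    then show ?thesis
      by (subst AE_restrict_space_iff) auto
  qed
  then show ?thesis
    by (simp add: AE_all_countable)
qed

text \<open>
  Almost everywhere the squares of the Rademacher functions are \<open>1\<close>, so multiplying Walsh functions
  adds their binary digits modulo \<open>2\<close>: they are the characters of the dyadic group.
\<close>

lemma AE_walsh_mult:
  includes bit_operations_syntax
  shows "AE x in unit_lebesgue. walsh n x * walsh m x = walsh (n XOR m) x"
  using AE_rademacher_nonzero
proof eventually_elim
  case (elim x)
  define N where "N = Suc (n + m + (n XOR m))"
  have N: "n < N" "m < N" "n XOR m < N"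
    by (auto simp: N_def)
  have sq: "rademacher k x * rademacher k x = 1" for k
  proof -
    have "rademacher k x \<noteq> 0" using elim by blast
    then show ?thesis
      by (auto simp: rademacher_def sgn_real_def split: if_splits)
  qed
  show ?case
    unfolding walsh_eq_prod_bits[OF N(1)] walsh_eq_prod_bits[OF N(2)] walsh_eq_prod_bits[OF N(3)]
      prod.distrib[symmetric]
    by (intro prod.cong) (auto simp: bit_xor_iff sq)
qed

lemma rademacher_shift:
  "rademacher k (x + 1 / 2 ^ (k + 1)) = - rademacher k x"
proof -
  have "2 ^ (k + 1) * pi * (x + 1 / 2 ^ (k + 1)) = 2 ^ (k + 1) * pi * x + pi"
    by (simp add: distrib_left)
  then show ?thesis
    unfolding rademacher_def by (simp add: sgn_minus)
qed

lemma rademacher_periodic: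
  assumes "h = real j / 2 ^ k"
  shows "rademacher k (x + h) = rademacher k x"
proof -
  have "2 ^ (k + 1) * pi * (x + h) = 2 ^ (k + 1) * pi * x + of_nat j * (2 * pi)"
    by (simp add: distrib_left assms)
  then show ?thesis
    using sin.plus_of_nat[of "2 ^ (k + 1) * pi * x" j] by (simp add: rademacher_def)
qed

text \<open>
  By periodicity, translating by \<open>h\<close> does not change the integral over a period; by antiperiodicity it
  changes its sign.
\<close>

lemma integral_antiperiodic:
  fixes g :: "real \<Rightarrow> real"
  assumes int: "\<And>a b. g integrable_on {a..b}"
    and h: "0 \<le> h" "h \<le> 1"
    and anti: "\<And>x. g (x + h) = - g x"
    and per: "\<And>x. g (x + 1) = g x"
  shows "integral {0..1} g = 0"
proof -
  have "- integral {0..1} g = integral {0..1} (g \<circ> (+) h)"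
    by (simp add: anti o_def add.commute[of h])
  also have "\<dots> = integral {h..1 + h} g"
    by (simp add: integral_shift_Icc_real)
  also have "\<dots> = integral {h..1} g + integral {1..1 + h} g"
    by (rule Henstock_Kurzweil_Integration.integral_combine[symmetric]) (use h in \<open>auto intro: int\<close>)
  also have "integral {1..1 + h} g = integral {0..h} (g \<circ> (+) 1)"
    by (simp add: integral_shift_Icc_real add.commute)
  also have "\<dots> = integral {0..h} g"
    by (simp add: per o_def add.commute[of 1])
  also have "integral {h..1} g + integral {0..h} g = integral {0..1} g"
    by (subst add.commute, rule Henstock_Kurzweil_Integration.integral_combine) (use h in \<open>auto intro: int\<close>)
  finally show ?thesis
    by simp
qed

lemma walsh_borel_measurable [measurable]: "walsh n \<in> borel_measurable borel"
proof -
  have "rademacher k \<in> borel_measurable borel" for k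
  proof -
    have [measurable]: "(\<lambda>x::real. sin (2 ^ (k + 1) * pi * x)) \<in> borel_measurable borel"
      by (intro borel_measurable_continuous_onI continuous_intros)
    show ?thesis
      unfolding rademacher_def[abs_def] sgn_real_def by measurable
  qed
  then show ?thesis
    unfolding walsh_def[abs_def] by measurable
qed

text \<open>
  Let \<open>k\<close> be the lowest set bit of \<open>n\<close>. Translation by \<open>1 / 2 ^ (k + 1)\<close> is half a period of
  \<open>rademacher k\<close> and a whole number of periods of every later Rademacher function, while the earlier
  ones do not occur in \<open>walsh n\<close>. Hence \<open>walsh n\<close> changes sign under this translation.
\<close>

lemma integral_walsh:
  assumes "n \<noteq> 0"
  shows "(LINT x|unit_lebesgue. walsh n x) = 0"
proof -
  have int: "integrable (lebesgue_on {a..b}) (walsh n)" for a b :: real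
  proof (rule finite_measure.integrable_const_bound[where B = 1])
    show "finite_measure (lebesgue_on {a..b})"
      by (rule finite_measure_lebesgue_on) auto
    have "walsh n \<in> borel_measurable lebesgue"
      by (intro measurable_completion) simp
    then show "walsh n \<in> borel_measurable (lebesgue_on {a..b})"
      by (rule measurable_restrict_space1)
  qed (simp add: abs_walsh_le_1)
  define k where "k = (LEAST k. bit n k)"
  have "\<exists>k. bit n k"
    using assms by (auto simp: bit_eq_iff)
  then have k: "bit n k" "\<And>i. bit n i \<Longrightarrow> k \<le> i"
    unfolding k_def by (auto intro: LeastI_ex Least_le)
  note prod_bits = walsh_eq_prod_bits[OF lessI]
  have kn: "k < Suc n"
  proof -
    have "2 ^ k \<le> n"
      using k(1) by (cases "n < 2 ^ k") (auto simp: bit_iff_odd)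
    then show ?thesis
      using less_exp[of k] by linarith
  qed
  have "integral {0..1} (walsh n) = 0"
  proof (rule integral_antiperiodic)
    show "walsh n integrable_on {a..b}" for a b
      using int by (rule integrable_on_lebesgue_on) simp
    show "(0::real) \<le> 1 / 2 ^ (k + 1)" "1 / 2 ^ (k + 1) \<le> (1::real)"
      by (auto simp del: power_Suc)
    show "walsh n (x + 1) = walsh n x" for x
    proof -
      have "rademacher i (x + 1) = rademacher i x" for i
        by (rule rademacher_periodic[where j = "2 ^ i"]) simp
      then show ?thesis
        by (simp add: walsh_def)
    qed
    show "walsh n (x + 1 / 2 ^ (k + 1)) = - walsh n x" for x
    proof -
      have *: "(if bit n i then rademacher i (x + 1 / 2 ^ (k + 1)) else 1) =
          (if i = k then - 1 else 1) * (if bit n i then rademacher i x else 1)" for i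
      proof (cases "bit n i \<and> i \<noteq> k")
        case True
        then have "k < i"
          using k(2)[of i] by simp
        then have "(1::real) / 2 ^ (k + 1) = real (2 ^ (i - Suc k)) / 2 ^ i"
          by (simp add: field_simps flip: power_add power_Suc)
        then have "rademacher i (x + 1 / 2 ^ (k + 1)) = rademacher i x"
          by (rule rademacher_periodic)
        then show ?thesis
          using True by simp
      next
        case False
        then show ?thesis
          using k(1) rademacher_shift[of k x] by (cases "i = k") (simp_all del: power_Suc)
      qed
      show ?thesis
        unfolding prod_bits * prod.distrib using kn by (simp add: prod.delta)
    qed
  qed
  then show ?thesis
    using int by (simp add: lebesgue_integral_eq_integral)
qed

lemma integral_walsh_mult:
  includes bit_operations_syntax
  shows
  "(LINT x|unit_lebesgue. walsh n x * walsh m x) = (if n = m then 1 else 0)"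
proof -
  have "(LINT x|unit_lebesgue. walsh n x * walsh m x) = (LINT x|unit_lebesgue. walsh (n XOR m) x)"
    by (intro integral_cong_AE AE_walsh_mult) auto
  also have "\<dots> = (if n = m then 1 else 0)"
  proof (cases "n = m")
    case True
    then show ?thesis
      by (simp add: measure_restrict_space)
  next
    case False
    then have "n XOR m \<noteq> 0"
      by (auto simp: bit_eq_iff bit_xor_iff)
    then show ?thesis
      using False by (simp add: integral_walsh)
  qed
  finally show ?thesis .
qed

section \<open>Totality of the Walsh system\<close>

text \<open>
  On a dyadic interval of level \<open>k\<close> the function \<open>rademacher k\<close> is \<open>1\<close> on the left half and
  \<open>-1\<close> on the right half, so \<open>(1 + rademacher k) / 2\<close> and \<open>(1 - rademacher k) / 2\<close> cut out the two
  halves. The identities can fail only at endpoints and midpoints.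
\<close>

lemma AE_dyadic_child:
  "AE x in unit_lebesgue. \<forall>k j.
     indicat_real {real (2 * j) / 2 ^ Suc k..<real (2 * j + 1) / 2 ^ Suc k} x
       = indicat_real {real j / 2 ^ k..<real (j + 1) / 2 ^ k} x * (1 + rademacher k x) / 2 \<and>
     indicat_real {real (2 * j + 1) / 2 ^ Suc k..<real (2 * j + 2) / 2 ^ Suc k} x
       = indicat_real {real j / 2 ^ k..<real (j + 1) / 2 ^ k} x * (1 - rademacher k x) / 2"
  using AE_rademacher_nonzero
proof eventually_elim
  case (elim x)
  show ?case
  proof (intro allI)
    fix k j :: nat
    \<comment> \<open>In the coordinate \<open>y\<close> the parent interval is \<open>[0, 2)\<close> and its midpoint is \<open>1\<close>.\<close>
    define y where "y = 2 ^ Suc k * x - 2 * real j"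
    have x: "x = (y + 2 * real j) / 2 ^ Suc k"
      by (simp add: y_def)
    have le: "a / 2 ^ Suc k \<le> x \<longleftrightarrow> a - 2 * real j \<le> y"
      "x < a / 2 ^ Suc k \<longleftrightarrow> y < a - 2 * real j" for a
      unfolding x by (auto simp: divide_le_cancel divide_less_cancel simp del: power_Suc)
    have parent: "real j / 2 ^ k = (2 * real j) / 2 ^ Suc k"
      "real (j + 1) / 2 ^ k = (2 * real j + 2) / 2 ^ Suc k"
      by (simp_all add: field_simps)
    have "2 ^ (k + 1) * pi * x = pi * y + of_nat j * (2 * pi)"
      by (simp add: y_def algebra_simps)
    then have r: "rademacher k x = sgn (sin (pi * y))"
      using sin.plus_of_nat[of "pi * y" j] by (simp add: rademacher_def)
    have "rademacher k x \<noteq> 0"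
      using elim by blast
    then have y: "y \<noteq> 0" "y \<noteq> 1"
      by (auto simp: r)
    have pos: "rademacher k x = 1" if "0 < y" "y < 1"
      using that sin_gt_zero[of "pi * y"] by (simp add: r)
    have neg: "rademacher k x = -1" if "1 < y" "y < 2"
    proof -
      have "0 < sin (pi * (y - 1))"
        using that by (intro sin_gt_zero) auto
      then show ?thesis
        by (simp add: r right_diff_distrib sin_diff)
    qed
    show "indicat_real {real (2 * j) / 2 ^ Suc k..<real (2 * j + 1) / 2 ^ Suc k} x
       = indicat_real {real j / 2 ^ k..<real (j + 1) / 2 ^ k} x * (1 + rademacher k x) / 2 \<and>
     indicat_real {real (2 * j + 1) / 2 ^ Suc k..<real (2 * j + 2) / 2 ^ Suc k} x
       = indicat_real {real j / 2 ^ k..<real (j + 1) / 2 ^ k} x * (1 - rademacher k x) / 2"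
    proof (cases "0 < y \<and> y < 1 \<or> 1 < y \<and> y < 2")
      case True
      then show ?thesis
        unfolding parent using pos neg by (auto simp: indicator_def le simp del: power_Suc)
    next
      case False
      then have "y < 0 \<or> 2 \<le> y"
        using y by auto
      then show ?thesis
        unfolding parent by (auto simp: indicator_def le simp del: power_Suc)
    qed
  qed
qed

lemma integrable_bounded_multiple:
  fixes f :: "real \<Rightarrow> complex" and g :: "real \<Rightarrow> real"
  assumes f: "integrable unit_lebesgue f"
    and g: "g \<in> borel_measurable borel" "\<And>x. \<bar>g x\<bar> \<le> 1"
  shows "integrable unit_lebesgue (\<lambda>x. f x * complex_of_real (g x))"
proof -
  note [measurable] = borel_measurable_integrable[OF f]
  have "g \<in> borel_measurable lebesgue"
    using g(1) by (intro measurable_completion) simp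
  then have [measurable]: "g \<in> borel_measurable unit_lebesgue"
    by (rule measurable_restrict_space1)
  show ?thesis
    using g(2)
    by (intro Bochner_Integration.integrable_bound[OF f]) (auto simp: norm_mult mult_left_le)
qed

lemma integrable_walsh_indicator:
  fixes f :: "real \<Rightarrow> complex"
  assumes f: "integrable unit_lebesgue f" and [measurable]: "A \<in> sets borel"
  shows "integrable unit_lebesgue (\<lambda>x. f x * complex_of_real (indicat_real A x * walsh n x))"
proof (rule integrable_bounded_multiple[OF f])
  show "(\<lambda>x. indicat_real A x * walsh n x) \<in> borel_measurable borel"
    by measurable
qed (auto simp: indicator_def abs_walsh_le_1)

lemma set_integrable_borel:
  fixes f :: "real \<Rightarrow> complex"
  assumes "integrable unit_lebesgue f" "A \<in> sets borel"
  shows "set_integrable unit_lebesgue A f"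
  using integrable_bounded_multiple[OF assms(1), of "indicat_real A"] assms(2)
  by (simp add: set_integrable_def scaleR_conv_of_real mult.commute)

context
  fixes f :: "real \<Rightarrow> complex"
  assumes f: "integrable unit_lebesgue f"
    and coeff: "\<And>n. (LINT x|unit_lebesgue. f x * complex_of_real (walsh n x)) = 0"
begin

text \<open>
  Induction on the level. Splitting an interval in half replaces its indicator by
  \<open>(1 \<plusminus> rademacher k) / 2\<close> times the indicator of the parent, and the factor \<open>rademacher k\<close> turns
  \<open>walsh n\<close> into \<open>walsh (n + 2 ^ k)\<close>. This is why the claim is made for all multiples \<open>n\<close> of
  \<open>2 ^ k\<close>, which leave the bits below \<open>k\<close> free for the Rademacher functions that carve out the
  interval, although it is the case \<open>n = 0\<close> that is used later.
\<close>

lemma integral_walsh_dyadic: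
  assumes "j < 2 ^ k" "2 ^ k dvd n"
  shows "(LINT x|unit_lebesgue. f x * complex_of_real
       (indicat_real {real j / 2 ^ k..<real (j + 1) / 2 ^ k} x * walsh n x)) = 0"
  using assms
proof (induction k arbitrary: j n)
  case 0
  have "AE x in unit_lebesgue. f x * complex_of_real (indicat_real {0..<1} x * walsh n x)
      = f x * complex_of_real (walsh n x)"
    using AE_rademacher_nonzero AE_space
  proof eventually_elim
    case (elim x)
    \<comment> \<open>The point \<open>1\<close> belongs to the unit interval but to no dyadic interval; it lies in the null set
      where a Rademacher function vanishes.\<close>
    have "rademacher 0 1 = 0"
      by (simp add: rademacher_def)
    with elim have "x \<noteq> 1"
      by auto
    with elim show ?case
      by (auto simp: indicator_def)
  qed
  then have "(LINT x|unit_lebesgue. f x * complex_of_real (indicat_real {0..<1} x * walsh n x))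
      = (LINT x|unit_lebesgue. f x * complex_of_real (walsh n x))"
    by (intro integral_cong_AE borel_measurable_integrable[OF integrable_walsh_indicator[OF f]]
        borel_measurable_integrable[OF integrable_bounded_multiple[OF f]]) (auto simp: abs_walsh_le_1)
  then show ?case
    using 0 coeff by simp
next
  case (Suc k)
  define i b where "i = j div 2" and "b = j mod 2"
  have j: "j = 2 * i + b" and b: "b = 0 \<or> b = 1"
    by (auto simp: i_def b_def)
  have i: "i < 2 ^ k"
    using Suc.prems(1) by (simp add: i_def less_mult_imp_div_less)
  have n: "2 ^ k dvd n" "2 ^ k dvd n + 2 ^ k"
    using Suc.prems(2) by (auto dest: dvd_mult_right)
  have bit: "\<not> bit n k"
    using Suc.prems(2) by (auto simp: bit_iff_odd elim!: dvdE)
  define J where "J = {real j / 2 ^ Suc k..<real (j + 1) / 2 ^ Suc k}"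
  define I where "I = {real i / 2 ^ k..<real (i + 1) / 2 ^ k}"
  define s :: real where "s = (if b = 0 then 1 else - 1)"
  let ?h = "\<lambda>A n x. f x * complex_of_real (indicat_real A x * walsh n x)"
  have [measurable]: "I \<in> sets borel" "J \<in> sets borel"
    by (auto simp: I_def J_def)
  have "AE x in unit_lebesgue. ?h J n x = 1/2 * ?h I n x + of_real s / 2 * ?h I (n + 2 ^ k) x"
    using AE_dyadic_child
  proof eventually_elim
    case (elim x)
    have "indicat_real J x = indicat_real I x * (1 + s * rademacher k x) / 2"
      using elim[rule_format, of i k] b by (auto simp: J_def I_def s_def j add.commute)
    then show ?case
      unfolding walsh_add_power[OF bit] by (simp add: algebra_simps add_divide_distrib)
  qed
  then have "(LINT x|unit_lebesgue. ?h J n x)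
      = (LINT x|unit_lebesgue. 1/2 * ?h I n x + of_real s / 2 * ?h I (n + 2 ^ k) x)"
    by (intro integral_cong_AE borel_measurable_integrable Bochner_Integration.integrable_add
        integrable_mult_right integrable_walsh_indicator[OF f]) auto
  also have "\<dots> = 1/2 * (LINT x|unit_lebesgue. ?h I n x)
      + of_real s / 2 * (LINT x|unit_lebesgue. ?h I (n + 2 ^ k) x)"
    by (subst Bochner_Integration.integral_add)
      (auto intro!: integrable_mult_right integrable_walsh_indicator[OF f] simp del: of_real_mult)
  also have "\<dots> = 0"
    using Suc.IH[OF i n(1)] Suc.IH[OF i n(2)] by (simp add: I_def)
  finally show ?case
    by (simp add: J_def)
qed

lemma set_integral_lessThan_dyadic:
  "j \<le> 2 ^ k \<Longrightarrow> (LINT x:{..<real j / 2 ^ k}|unit_lebesgue. f x) = 0"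
proof (induction j)
  case 0
  have "(LINT x:{..<0}|unit_lebesgue. f x) = (LINT x|unit_lebesgue. 0)"
    unfolding set_lebesgue_integral_def
    by (rule Bochner_Integration.integral_cong) (auto simp: indicator_def)
  then show ?case
    by simp
next
  case (Suc j)
  have "(LINT x:{..<real (Suc j) / 2 ^ k}|unit_lebesgue. f x)
      = (LINT x:{..<real j / 2 ^ k} \<union> {real j / 2 ^ k..<real (j + 1) / 2 ^ k}|unit_lebesgue. f x)"
    by (subst ivl_disj_un) (auto simp: divide_right_mono)
  also have "\<dots> = (LINT x:{..<real j / 2 ^ k}|unit_lebesgue. f x)
      + (LINT x:{real j / 2 ^ k..<real (j + 1) / 2 ^ k}|unit_lebesgue. f x)"
    by (intro set_integral_Un set_integrable_borel[OF f]) auto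
  also have "\<dots> = 0"
    using Suc integral_walsh_dyadic[of j k 0]
    by (simp add: set_lebesgue_integral_def scaleR_conv_of_real mult.commute)
  finally show ?case .
qed

text \<open>
  The dyadic rationals \<open>\<lfloor>2 ^ k * c\<rfloor> / 2 ^ k\<close> approach \<open>c\<close> from below, so the indicators of the
  corresponding half-lines converge pointwise, and dominated convergence carries over the vanishing of the integral.
\<close>

lemma set_integral_lessThan: "(LINT x:{..<c}|unit_lebesgue. f x) = 0"
proof -
  have unit: "(LINT x:{..<c}|unit_lebesgue. f x) = 0" if c: "0 \<le> c" "c \<le> 1" for c
  proof -
    define d where "d k = real (nat \<lfloor>2 ^ k * c\<rfloor>) / 2 ^ k" for k :: nat
    have floor: "real (nat \<lfloor>2 ^ k * c\<rfloor>) = of_int \<lfloor>2 ^ k * c\<rfloor>" for k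
      using c by simp
    have d_le: "d k \<le> c" for k
      unfolding d_def floor by (simp add: divide_le_eq mult.commute)
    have d_ge: "c - (1/2) ^ k \<le> d k" for k
    proof -
      have "2 ^ k * c \<le> of_int \<lfloor>2 ^ k * c\<rfloor> + 1"
        by linarith
      then show ?thesis
        unfolding d_def floor by (simp add: power_one_over le_divide_eq algebra_simps)
    qed
    have d_lim: "d \<longlonglongrightarrow> c"
    proof (rule tendsto_sandwich)
      show "(\<lambda>k. c - (1/2) ^ k) \<longlonglongrightarrow> c"
        using tendsto_diff[OF tendsto_const LIMSEQ_power_zero[of "1/2 :: real"]] by simp
    qed (use d_le d_ge in auto)
    have zero: "(LINT x:{..<d k}|unit_lebesgue. f x) = 0" for k
    proof -
      have "2 ^ k * c \<le> 2 ^ k * 1"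
        using c by (intro mult_left_mono) auto
      then have "real (nat \<lfloor>2 ^ k * c\<rfloor>) \<le> real (2 ^ k)"
        unfolding floor using of_int_floor_le[of "2 ^ k * c"] by (metis mult_1_right of_nat_numeral of_nat_power order_trans)
      then have "nat \<lfloor>2 ^ k * c\<rfloor> \<le> 2 ^ k"
        unfolding of_nat_le_iff .
      then show ?thesis
        unfolding d_def by (rule set_integral_lessThan_dyadic)
    qed
    have "(\<lambda>k. LINT x:{..<d k}|unit_lebesgue. f x) \<longlonglongrightarrow> (LINT x:{..<c}|unit_lebesgue. f x)"
      unfolding set_lebesgue_integral_def
    proof (rule integral_dominated_convergence)
      show "integrable unit_lebesgue (\<lambda>x. norm (f x))"
        using f by simp
      show "AE x in unit_lebesgue. (\<lambda>k. indicat_real {..<d k} x *\<^sub>R f x) \<longlonglongrightarrow> indicat_real {..<c} x *\<^sub>R f x"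
      proof (intro AE_I2 tendsto_scaleR tendsto_const)
        show "(\<lambda>k. indicat_real {..<d k} x) \<longlonglongrightarrow> indicat_real {..<c} x" for x
        proof (cases "x < c")
          case True
          then have "\<forall>\<^sub>F k in sequentially. indicat_real {..<d k} x = indicat_real {..<c} x"
            using order_tendstoD(1)[OF d_lim True] by (auto elim!: eventually_mono)
          then show ?thesis
            by (rule tendsto_eventually)
        next
          case False
          then have "indicat_real {..<d k} x = indicat_real {..<c} x" for k
            using d_le[of k] by simp
          then show ?thesis
            by simp
        qed
      qed
      show "AE x in unit_lebesgue. norm (indicat_real {..<d k} x *\<^sub>R f x) \<le> norm (f x)" for k
        by (auto simp: indicator_def)
    qed (use set_integrable_borel[OF f] in \<open>auto simp: set_integrable_def\<close>)
    then show ?thesis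
      by (simp add: zero LIMSEQ_const_iff)
  qed
  show ?thesis
  proof (cases "0 \<le> c \<and> c \<le> 1")
    case False
    then have "(LINT x:{..<c}|unit_lebesgue. f x)
        = (LINT x|unit_lebesgue. (if c < 0 then 0 else f x * complex_of_real (walsh 0 x)))"
      unfolding set_lebesgue_integral_def
      by (intro Bochner_Integration.integral_cong) (auto simp: indicator_def)
    then show ?thesis
      using coeff[of 0] by (cases "c < 0") auto
  qed (use unit in auto)
qed

text \<open>
  The sets on which the integral of \<open>f\<close> vanishes form a Dynkin system, and the half-lines are an
  intersection-stable generator of the Borel sets.
\<close>

lemma set_integral_borel:
  assumes "A \<in> sets borel"
  shows "(LINT x:A|unit_lebesgue. f x) = 0"
proof -
  have stable: "Int_stable (range lessThan :: real set set)"
  proof -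
    have "{..<a} \<inter> {..<b} = {..<min a b}" for a b :: real
      by auto
    then show ?thesis
      by (auto simp: Int_stable_def)
  qed
  have "A \<in> sigma_sets UNIV (range lessThan)"
    using assms unfolding borel_Iio by simp
  with stable subset_UNIV[of "range lessThan", folded Pow_UNIV] show ?thesis
  proof (induction rule: sigma_sets_induct_disjoint)
    case (basic A)
    then show ?case
      using set_integral_lessThan by auto
  next
    case empty
    show ?case
      by (simp add: set_lebesgue_integral_def)
  next
    case (compl A)
    then have A: "A \<in> sets borel"
      unfolding borel_Iio by simp
    have "(LINT x:A \<union> (UNIV - A)|unit_lebesgue. f x)
        = (LINT x:A|unit_lebesgue. f x) + (LINT x:UNIV - A|unit_lebesgue. f x)"
      using A by (intro set_integral_Un set_integrable_borel[OF f]) auto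
    then show ?case
      using coeff[of 0] compl.IH by (simp add: set_lebesgue_integral_def)
  next
    case (union A)
    then have A: "A i \<in> sets borel" for i
      unfolding borel_Iio by auto
    \<comment> \<open>Countable additivity speaks of measurable sets of the restricted measure, hence the
      intersection with the unit interval.\<close>
    have "(LINT x:(\<Union>i. A i \<inter> {0..1})|unit_lebesgue. f x) = (\<Sum>i. LINT x:A i \<inter> {0..1}|unit_lebesgue. f x)"
    proof (rule lebesgue_integral_countable_add)
      show "A i \<inter> {0..1} \<in> sets unit_lebesgue" for i
        using A by (auto simp: sets_restrict_space)
      show "set_integrable unit_lebesgue (\<Union>i. A i \<inter> {0..1}) f"
        using A by (intro set_integrable_borel[OF f] sets.countable_UN) auto
    qed (use union.hyps in \<open>auto simp: disjoint_family_on_def\<close>)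
    moreover have "(LINT x:B \<inter> {0..1}|unit_lebesgue. f x) = (LINT x:B|unit_lebesgue. f x)" for B
      unfolding set_lebesgue_integral_def
      by (intro Bochner_Integration.integral_cong) (auto simp: indicator_def)
    ultimately show ?case
      using union.IH by (simp flip: Int_UN_distrib2 add: UN_simps)
  qed
qed

text \<open>
  Totality of the Walsh system, even for integrable functions: a Lebesgue set differs from a Borel set
  by a null set, so \<open>f\<close> has integral zero over every measurable set.
\<close>

lemma AE_zero_if_walsh_coefficients_zero: "AE x in unit_lebesgue. f x = 0"
proof (rule sigma_finite_measure.density_zero)
  show "sigma_finite_measure unit_lebesgue"
    by (intro finite_measure.axioms(1) finite_measure_lebesgue_on) auto
  note [measurable] = borel_measurable_integrable[OF f]
  fix A assume "A \<in> sets unit_lebesgue"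
  then have A: "A \<in> sets (completion lborel)" 
    by (auto simp: sets_restrict_space)
  then obtain S N N' where S: "A = S \<union> N" "N \<subseteq> N'" "N' \<in> null_sets lborel" "S \<in> sets borel"
    by (auto simp: sets_completion)
  have "AE x in lebesgue. x \<notin> N'"
    using S(3) by (intro AE_not_in null_sets_completionI)
  then have N': "AE x in unit_lebesgue. x \<notin> N'"
    by (subst AE_restrict_space_iff) auto
  have "(LINT x:A|unit_lebesgue. f x) = (LINT x:S|unit_lebesgue. f x)"
    unfolding set_lebesgue_integral_def
  proof (rule integral_cong_AE)
    show "AE x in unit_lebesgue. indicat_real A x *\<^sub>R f x = indicat_real S x *\<^sub>R f x"
      using N' by eventually_elim (use S(1,2) in \<open>auto simp: indicator_def\<close>)
    have "indicat_real A \<in> borel_measurable lebesgue"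
      using A by simp
    then have [measurable]: "indicat_real A \<in> borel_measurable unit_lebesgue"
      by (rule measurable_restrict_space1)
    show "(\<lambda>x. indicat_real A x *\<^sub>R f x) \<in> borel_measurable unit_lebesgue"
      by measurable
    show "(\<lambda>x. indicat_real S x *\<^sub>R f x) \<in> borel_measurable unit_lebesgue"
      using set_integrable_borel[OF f S(4)] by (auto simp: set_integrable_def)
  qed
  then show "(LINT x:A|unit_lebesgue. f x) = 0"
    using set_integral_borel[OF S(4)] by simp
qed (rule f)

end

section \<open>Completeness of the space of square-integrable functions\<close>

lemma norm_L2_abs:
  assumes "square_integrable f"
  shows "(norm (abs_L2 f))\<^sup>2 = (LINT x|unit_lebesgue. (cmod (f x))\<^sup>2)"
  using assms by (simp add: norm_L2.abs_eq L2_rel_def integral_nonneg_AE)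

lemma L2_representative: "\<exists>f. square_integrable f \<and> u = abs_L2 f"
  by (induct u rule: L2.abs_induct) (auto simp: L2_rel_def)

lemma nn_integral_square_L2:
  assumes "square_integrable f"
  shows "(\<integral>\<^sup>+x. ennreal ((cmod (f x))\<^sup>2) \<partial>unit_lebesgue) = ennreal ((norm (abs_L2 f))\<^sup>2)"
  using assms unfolding norm_L2_abs[OF assms]
  by (intro nn_integral_eq_integral) (auto simp: square_integrable_def)

lemma abs_L2_diff:
  assumes "square_integrable f" "square_integrable g"
  shows "abs_L2 f - abs_L2 g = abs_L2 (\<lambda>x. f x - g x)"
  using assms by (intro minus_L2.abs_eq) (auto simp: L2_rel_def)

text \<open>
  A form of the Cauchy-Schwarz inequality on a probability space, obtained from
  \<open>2 t \<le> 2 ^ n * t\<^sup>2 + 1 / 2 ^ n\<close>.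
\<close>

lemma nn_integral_norm_le_geometric:
  assumes f: "square_integrable f" and le: "norm (abs_L2 f) \<le> (1/2) ^ n"
  shows "(\<integral>\<^sup>+x. ennreal (cmod (f x)) \<partial>unit_lebesgue) \<le> ennreal ((1/2) ^ n)"
proof -
  interpret finite_measure unit_lebesgue
    by (rule finite_measure_lebesgue_on) auto
  have [measurable]: "f \<in> borel_measurable unit_lebesgue"
    using f by (simp add: square_integrable_def)
  have amgm: "cmod (f x) \<le> 2 ^ n / 2 * (cmod (f x))\<^sup>2 + (1/2) ^ n / 2" for x
  proof -
    have "0 \<le> (2 ^ n * cmod (f x) - 1)\<^sup>2"
      by simp
    then have "2 ^ n * (2 * cmod (f x)) \<le> 2 ^ n * (2 ^ n * (cmod (f x))\<^sup>2) + 1"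
      by (simp add: power2_eq_square algebra_simps)
    also have "\<dots> = 2 ^ n * (2 ^ n * (cmod (f x))\<^sup>2 + (1/2) ^ n)"
      by (simp add: distrib_left flip: power_mult_distrib)
    finally show ?thesis
      by (subst (asm) mult_le_cancel_left_pos) auto
  qed
  have int: "integrable unit_lebesgue (\<lambda>x. 2 ^ n / 2 * (cmod (f x))\<^sup>2 + (1/2) ^ n / 2)"
    using f by (intro Bochner_Integration.integrable_add integrable_mult_right)
      (auto simp: square_integrable_def)
  have "(\<integral>\<^sup>+x. ennreal (cmod (f x)) \<partial>unit_lebesgue)
      \<le> (\<integral>\<^sup>+x. ennreal (2 ^ n / 2 * (cmod (f x))\<^sup>2 + (1/2) ^ n / 2) \<partial>unit_lebesgue)"
    by (intro nn_integral_mono ennreal_leI amgm)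
  also have "\<dots> = ennreal (LINT x|unit_lebesgue. 2 ^ n / 2 * (cmod (f x))\<^sup>2 + (1/2) ^ n / 2)"
    using int by (intro nn_integral_eq_integral) auto
  also have "(LINT x|unit_lebesgue. 2 ^ n / 2 * (cmod (f x))\<^sup>2 + (1/2) ^ n / 2) =
      2 ^ n / 2 * (norm (abs_L2 f))\<^sup>2 + (1/2) ^ n / 2"
    using f unfolding norm_L2_abs[OF f]
    by (subst Bochner_Integration.integral_add) (auto simp: square_integrable_def measure_restrict_space)
  also have "\<dots> \<le> (1/2) ^ n"
  proof -
    have "2 ^ n / 2 * (norm (abs_L2 f))\<^sup>2 \<le> 2 ^ n / 2 * ((1/2) ^ n)\<^sup>2"
      using le by (intro mult_left_mono power_mono) auto
    also have "\<dots> = (1/2) ^ n / (2::real)"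
      by (simp add: power2_eq_square field_simps)
    finally show ?thesis
      by (simp add: field_simps)
  qed
  finally show ?thesis
    by (simp add: ennreal_leI)
qed

text \<open>
  The increments have summable norms in \<open>L\<^sup>1\<close>, so the telescoping series converges absolutely
  almost everywhere.
\<close>

lemma L2_fast_Cauchy_AE_convergent:
  assumes F: "\<And>n. square_integrable (F n)"
    and fast: "\<And>n. norm (abs_L2 (F (Suc n)) - abs_L2 (F n)) \<le> (1/2) ^ n"
  shows "AE x in unit_lebesgue. convergent (\<lambda>n. F n x)"
proof -
  have [measurable]: "F n \<in> borel_measurable unit_lebesgue" for n
    using F by (simp add: square_integrable_def)
  define G where "G n x = F (Suc n) x - F n x" for n x
  have [measurable]: "G n \<in> borel_measurable unit_lebesgue" for n
    unfolding G_def by measurable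
  have "(\<integral>\<^sup>+x. (\<Sum>n. ennreal (cmod (G n x))) \<partial>unit_lebesgue)
      = (\<Sum>n. \<integral>\<^sup>+x. ennreal (cmod (G n x)) \<partial>unit_lebesgue)"
    by (intro nn_integral_suminf) simp
  also have "\<dots> \<le> (\<Sum>n. ennreal ((1/2) ^ n))"
  proof (intro suminf_le nn_integral_norm_le_geometric)
    show "square_integrable (G n)" for n
      unfolding G_def by (intro square_integrable_diff F)
    show "norm (abs_L2 (G n)) \<le> (1/2) ^ n" for n
      using fast[of n] F by (simp add: G_def[abs_def] abs_L2_diff)
  qed auto
  also have "\<dots> = ennreal (\<Sum>n. (1/2) ^ n)"
    by (intro suminf_ennreal2 summable_geometric) auto
  also have "\<dots> < \<infinity>"
    by simp
  finally have "AE x in unit_lebesgue. (\<Sum>n. ennreal (cmod (G n x))) \<noteq> \<infinity>"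
    by (intro nn_integral_PInf_AE) auto
  then show ?thesis
  proof eventually_elim
    case (elim x)
    then have "summable (\<lambda>n. cmod (G n x))"
      by (intro summable_suminf_not_top) auto
    then have "summable (\<lambda>n. G n x)"
      by (rule summable_norm_cancel)
    then have "convergent (\<lambda>n. \<Sum>k<n. G k x)"
      by (simp add: summable_iff_convergent)
    then have "convergent (\<lambda>n. F n x - F 0 x)"
      by (simp add: G_def sum_lessThan_telescope[of "\<lambda>k. F k x"])
    then have "convergent (\<lambda>n. (F n x - F 0 x) + F 0 x)"
      by (intro convergent_add convergent_const)
    then show ?case
      by simp
  qed
qed

text \<open>
  Fatou's lemma, applied to \<open>\<bar>F m - F n\<bar>\<^sup>2\<close> as \<open>n\<close> tends to infinity, bounds the distance from
  \<open>F m\<close> to the pointwise limit by the Cauchy modulus. This gives square integrability of the limit as well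
  as convergence to it in norm.
\<close>

lemma L2_AE_limit_Cauchy:
  assumes F: "\<And>n. square_integrable (F n)"
    and Cauchy: "Cauchy (\<lambda>n. abs_L2 (F n))"
    and AE: "AE x in unit_lebesgue. convergent (\<lambda>n. F n x)"
  shows "convergent (\<lambda>n. abs_L2 (F n))"
proof -
  have [measurable]: "F n \<in> borel_measurable unit_lebesgue" for n
    using F by (simp add: square_integrable_def)
  define g where "g x = lim (\<lambda>n. F n x)" for x
  have [measurable]: "g \<in> borel_measurable unit_lebesgue"
    unfolding g_def by measurable
  have fatou: "(\<integral>\<^sup>+x. ennreal ((cmod (F m x - g x))\<^sup>2) \<partial>unit_lebesgue) \<le> ennreal (e\<^sup>2)"
    if e: "0 \<le> e" "\<And>n. m \<le> n \<Longrightarrow> norm (abs_L2 (F m) - abs_L2 (F n)) \<le> e" for m e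
  proof -
    have "(\<integral>\<^sup>+x. ennreal ((cmod (F m x - g x))\<^sup>2) \<partial>unit_lebesgue)
        = (\<integral>\<^sup>+x. liminf (\<lambda>n. ennreal ((cmod (F m x - F n x))\<^sup>2)) \<partial>unit_lebesgue)"
    proof (rule nn_integral_cong_AE)
      show "AE x in unit_lebesgue. ennreal ((cmod (F m x - g x))\<^sup>2)
          = liminf (\<lambda>n. ennreal ((cmod (F m x - F n x))\<^sup>2))"
        using AE
      proof eventually_elim
        case (elim x)
        then have "(\<lambda>n. F n x) \<longlonglongrightarrow> g x"
          by (simp add: g_def convergent_LIMSEQ_iff)
        then have "(\<lambda>n. ennreal ((cmod (F m x - F n x))\<^sup>2)) \<longlonglongrightarrow> ennreal ((cmod (F m x - g x))\<^sup>2)"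
          by (intro tendsto_ennrealI tendsto_intros)
        then show ?case
          using lim_imp_Liminf[OF sequentially_bot] by metis
      qed
    qed
    also have "\<dots> \<le> liminf (\<lambda>n. \<integral>\<^sup>+x. ennreal ((cmod (F m x - F n x))\<^sup>2) \<partial>unit_lebesgue)"
      by (intro nn_integral_liminf) simp
    also have "\<dots> \<le> ennreal (e\<^sup>2)"
    proof (rule Liminf_le)
      have "(\<integral>\<^sup>+x. ennreal ((cmod (F m x - F n x))\<^sup>2) \<partial>unit_lebesgue) \<le> ennreal (e\<^sup>2)" if "m \<le> n" for n
        unfolding nn_integral_square_L2[OF square_integrable_diff[OF F F]]
        using e(2)[OF that] by (intro ennreal_leI power_mono) (auto simp: abs_L2_diff F)
      then show "\<forall>\<^sub>F n in sequentially.
          (\<integral>\<^sup>+x. ennreal ((cmod (F m x - F n x))\<^sup>2) \<partial>unit_lebesgue) \<le> ennreal (e\<^sup>2)"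
        by (auto simp: eventually_sequentially)
    qed simp
    finally show ?thesis .
  qed
  have diff: "square_integrable (\<lambda>x. F m x - g x)"
    if "0 \<le> e" "\<And>n. m \<le> n \<Longrightarrow> norm (abs_L2 (F m) - abs_L2 (F n)) \<le> e" for m e
    unfolding square_integrable_def
  proof (intro conjI integrableI_bounded)
    have "(\<integral>\<^sup>+x. ennreal (norm ((cmod (F m x - g x))\<^sup>2)) \<partial>unit_lebesgue) \<le> ennreal (e\<^sup>2)"
      using fatou[OF that] by simp
    also have "\<dots> < \<infinity>" by simp
    finally show "(\<integral>\<^sup>+x. ennreal (norm ((cmod (F m x - g x))\<^sup>2)) \<partial>unit_lebesgue) < \<infinity>" .
  qed auto
  have tail: "\<exists>M. \<forall>m\<ge>M. \<forall>n\<ge>m. norm (abs_L2 (F m) - abs_L2 (F n)) \<le> e" if "0 < e" for e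
    using CauchyD[OF Cauchy that] by (meson less_imp_le order_trans)
  obtain M where "\<forall>m\<ge>M. \<forall>n\<ge>m. norm (abs_L2 (F m) - abs_L2 (F n)) \<le> 1"
    using tail[of 1] by auto
  then have "square_integrable (\<lambda>x. F M x - g x)"
    by (intro diff[of 1 M]) auto
  from square_integrable_diff[OF F[of M] this] have g: "square_integrable g"
    by simp
  have "(\<lambda>n. abs_L2 (F n)) \<longlonglongrightarrow> abs_L2 g"
  proof (rule LIMSEQ_I)
    fix e :: real assume "0 < e"
    then obtain M where M: "\<And>m n. M \<le> m \<Longrightarrow> m \<le> n \<Longrightarrow> norm (abs_L2 (F m) - abs_L2 (F n)) \<le> e / 2"
      using tail[of "e / 2"] by auto
    have "norm (abs_L2 (F m) - abs_L2 g) < e" if m: "M \<le> m" for m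
    proof -
      have "ennreal ((norm (abs_L2 (\<lambda>x. F m x - g x)))\<^sup>2) \<le> ennreal ((e / 2)\<^sup>2)"
        unfolding nn_integral_square_L2[OF square_integrable_diff[OF F g], symmetric]
        using \<open>0 < e\<close> M[OF m] by (intro fatou) auto
      then have "norm (abs_L2 (\<lambda>x. F m x - g x)) \<le> e / 2"
        using \<open>0 < e\<close> by (subst (asm) ennreal_le_iff) (auto intro: power2_le_imp_le)
      then show ?thesis
        using \<open>0 < e\<close> by (simp add: abs_L2_diff F g)
    qed
    then show "\<exists>M. \<forall>m\<ge>M. norm (abs_L2 (F m) - abs_L2 g) < e"
      by blast
  qed
  then show ?thesis
    by (rule convergentI)
qed

text \<open>
  The Riesz-Fischer theorem: a Cauchy sequence has a subsequence with geometrically decreasing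
  increments, which converges almost everywhere and therefore in norm; the whole sequence then has the same limit.
\<close>

instance L2 :: banach
proof
  fix u :: "nat \<Rightarrow> L2" assume u: "Cauchy u"
  have "\<exists>F. \<forall>n. square_integrable (F n) \<and> u n = abs_L2 (F n)"
    by (intro choice allI L2_representative)
  then obtain F where F: "\<And>n. square_integrable (F n)" and uF: "\<And>n. u n = abs_L2 (F n)"
    by blast
  have "\<exists>M. \<forall>m\<ge>M. \<forall>n\<ge>M. norm (u m - u n) < (1/2) ^ k" for k :: nat
    using CauchyD[OF u, of "(1/2) ^ k"] by simp
  then have "\<exists>M. \<forall>k. \<forall>m\<ge>M k. \<forall>n\<ge>M k. norm (u m - u n) < (1/2) ^ k"
    by (intro choice allI)
  then obtain M where M: "\<forall>m\<ge>M k. \<forall>n\<ge>M k. norm (u m - u n) < (1/2) ^ k" for k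
    by auto
  \<comment> \<open>Any strictly increasing sequence above \<open>M\<close> would do.\<close>
  define r where "r k = k + (\<Sum>i\<le>k. M i)" for k
  have r: "strict_mono r"
    by (auto simp: r_def strict_mono_Suc_iff)
  have "M k \<le> r k" for k
    using member_le_sum[of k "{..k}" M] by (simp add: r_def trans_le_add2)
  moreover have "r k \<le> r (Suc k)" for k
    by (simp add: r_def)
  ultimately have "norm (u (r (Suc k)) - u (r k)) \<le> (1/2) ^ k" for k
    using M[of k] by (meson less_imp_le order_trans)
  then have "AE x in unit_lebesgue. convergent (\<lambda>k. F (r k) x)"
    by (intro L2_fast_Cauchy_AE_convergent F) (simp add: uF)
  moreover have "Cauchy (\<lambda>k. abs_L2 (F (r k)))"
    using Cauchy_subseq_Cauchy[OF u r] by (simp add: o_def uF)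
  ultimately have "convergent (\<lambda>k. abs_L2 (F (r k)))"
    by (intro L2_AE_limit_Cauchy F)
  then obtain l where "(u \<circ> r) \<longlonglongrightarrow> l"
    by (auto simp: convergent_def o_def uF)
  with u r have "u \<longlonglongrightarrow> l"
    by (rule Cauchy_converges_subseq)
  then show "convergent u"
    by (rule convergentI)
qed

section \<open>Walsh series and Parseval's identity\<close>

lemma norm_scaleC: "norm (c *\<^sub>C f) = cmod c * norm f"
  by transfer (simp add: norm_mult power_mult_distrib real_sqrt_mult)

lemma walsh_coeff_add: "walsh_coeff (f + g) n = walsh_coeff f n + walsh_coeff g n"
proof (transfer fixing: n)
  fix f g assume "L2_rel f f" "L2_rel g g"
  then show "(LINT x|unit_lebesgue. (f x + g x) * complex_of_real (walsh n x)) =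
      (LINT x|unit_lebesgue. f x * complex_of_real (walsh n x)) +
      (LINT x|unit_lebesgue. g x * complex_of_real (walsh n x))"
    unfolding distrib_right
    by (intro Bochner_Integration.integral_add integrable_mult_square_integrable
        square_integrable_walsh) (auto simp: L2_rel_def)
qed

lemma walsh_coeff_scaleC: "walsh_coeff (c *\<^sub>C f) n = c * walsh_coeff f n"
  by transfer (simp add: mult.assoc)

lemma scaleR_eq_scaleC: "r *\<^sub>R f = complex_of_real r *\<^sub>C f" for f :: L2
  by transfer (auto simp: L2_rel_def square_integrable_mult)

text \<open>
  The inner product on \<open>L2\<close> is only the real part of the Hermitian one. Pairing with all complex multiples
  of \<open>walsh_L2 n\<close> recovers the complex coefficient.
\<close>

lemma inner_scaleC_walsh: "f \<bullet> (c *\<^sub>C walsh_L2 n) = Re (cnj c * walsh_coeff f n)"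
proof (transfer fixing: c n)
  fix f assume "L2_rel f f"
  then have int: "integrable unit_lebesgue (\<lambda>x. f x * complex_of_real (walsh n x))"
    by (intro integrable_mult_square_integrable square_integrable_walsh) (simp add: L2_rel_def)
  have "(LINT x|unit_lebesgue. f x \<bullet> (c * complex_of_real (walsh n x)))
      = (LINT x|unit_lebesgue. Re (cnj c * (f x * complex_of_real (walsh n x))))"
    by (simp add: inner_complex_def algebra_simps)
  also have "\<dots> = Re (cnj c * (LINT x|unit_lebesgue. f x * complex_of_real (walsh n x)))"
    using int by (subst integral_Re) auto
  finally show "(LINT x|unit_lebesgue. f x \<bullet> (c * complex_of_real (walsh n x)))
      = Re (cnj c * (LINT x|unit_lebesgue. f x * complex_of_real (walsh n x)))" .
qed

lemma walsh_coeff_walsh: "walsh_coeff (walsh_L2 n) m = (if n = m then 1 else 0)"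
proof (transfer fixing: n m)
  have "(LINT x|unit_lebesgue. complex_of_real (walsh n x) * complex_of_real (walsh m x))
      = complex_of_real (LINT x|unit_lebesgue. walsh n x * walsh m x)"
    by (simp flip: of_real_mult)
  then show "(LINT x|unit_lebesgue. complex_of_real (walsh n x) * complex_of_real (walsh m x))
      = (if n = m then 1 else 0)"
    by (simp add: integral_walsh_mult)
qed

lemma norm_walsh [simp]: "norm (walsh_L2 n) = 1"
proof -
  have "1 *\<^sub>C walsh_L2 n = walsh_L2 n"
    by transfer (auto simp: L2_rel_def square_integrable_walsh)
  then have "walsh_L2 n \<bullet> walsh_L2 n = 1"
    using inner_scaleC_walsh[of "walsh_L2 n" 1 n] by (simp add: walsh_coeff_walsh)
  then show ?thesis
    by (simp add: norm_eq_sqrt_inner)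
qed

lemma cmod_walsh_coeff_le: "cmod (walsh_coeff f n) \<le> norm f"
proof (cases "walsh_coeff f n = 0")
  case False
  have "(cmod (walsh_coeff f n))\<^sup>2 = f \<bullet> (walsh_coeff f n *\<^sub>C walsh_L2 n)"
    by (simp add: inner_scaleC_walsh cmod_power2 flip: power2_eq_square)
  also have "\<dots> \<le> norm f * cmod (walsh_coeff f n)"
    using norm_cauchy_schwarz[of f "walsh_coeff f n *\<^sub>C walsh_L2 n"] by (simp add: norm_scaleC)
  finally show ?thesis
    using False by (simp add: power2_eq_square)
qed simp

lemma bounded_linear_walsh_coeff: "bounded_linear (\<lambda>f. walsh_coeff f n)"
  by (rule bounded_linear_intro[where K = 1])
    (auto simp: walsh_coeff_add walsh_coeff_scaleC scaleR_eq_scaleC scaleR_conv_of_real cmod_walsh_coeff_le)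

lemmas walsh_coeff_diff = bounded_linear.linear[OF bounded_linear_walsh_coeff, THEN linear_diff]

text \<open>
  The totality of the Walsh system, as a principle for proving equations in \<open>L2\<close> coefficient by coefficient.
\<close>

lemma walsh_coeff_inject:
  assumes "\<And>n. walsh_coeff f n = walsh_coeff g n"
  shows "f = g"
proof -
  obtain h where h: "square_integrable h" "f - g = abs_L2 h"
    using L2_representative by blast
  have "(LINT x|unit_lebesgue. h x * complex_of_real (walsh n x)) = walsh_coeff (f - g) n" for n
    using h by (simp add: walsh_coeff.abs_eq L2_rel_def)
  then have "(LINT x|unit_lebesgue. h x * complex_of_real (walsh n x)) = 0" for n
    using assms by (simp add: walsh_coeff_diff)
  moreover have "integrable unit_lebesgue h"
    using integrable_mult_square_integrable[OF h(1) square_integrable_walsh[of 0]] by simp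
  ultimately have "AE x in unit_lebesgue. h x = 0"
    by (intro AE_zero_if_walsh_coefficients_zero)
  then have "(norm (f - g))\<^sup>2 = 0"
    unfolding h(2) norm_L2_abs[OF h(1)] by (intro integral_eq_zero_AE) auto
  then show ?thesis
    by simp
qed

lemma norm_walsh_polynomial:
  assumes "finite A"
  shows "(norm (\<Sum>n\<in>A. c n *\<^sub>C walsh_L2 n))\<^sup>2 = (\<Sum>n\<in>A. (cmod (c n))\<^sup>2)"
  using assms
  by (subst norm_sum_Pythagorean)
    (auto simp: pairwise_def orthogonal_def inner_scaleC_walsh walsh_coeff_scaleC walsh_coeff_walsh norm_scaleC)

text \<open>
  By Pythagoras the Cauchy criteria for both series are the same; completeness of \<open>L2\<close> makes the
  criterion on the left sufficient for convergence.
\<close>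

lemma Riesz_Fischer_walsh:
  "summable (\<lambda>n. c n *\<^sub>C walsh_L2 n) \<longleftrightarrow> summable (\<lambda>n. (cmod (c n))\<^sup>2)"
proof -
  have small: "norm (\<Sum>n\<in>A. c n *\<^sub>C walsh_L2 n) < e \<longleftrightarrow> norm (\<Sum>n\<in>A. (cmod (c n))\<^sup>2) < e\<^sup>2"
    if "finite A" "0 < e" for A e
  proof -
    have "t < e \<longleftrightarrow> t\<^sup>2 < e\<^sup>2" if "0 \<le> t" for t
      using \<open>0 < e\<close> that by (meson less_imp_le power2_less_imp_less power_strict_mono zero_less_numeral)
    then show ?thesis
      by (simp add: norm_walsh_polynomial[OF \<open>finite A\<close>] sum_nonneg)
  qed
  show ?thesis
    unfolding summable_Cauchy
  proof (intro iffI allI impI)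
    fix e :: real assume *: "\<forall>e>0. \<exists>N. \<forall>m\<ge>N. \<forall>n. norm (\<Sum>n\<in>{m..<n}. c n *\<^sub>C walsh_L2 n) < e" and "0 < e"
    then show "\<exists>N. \<forall>m\<ge>N. \<forall>n. norm (\<Sum>n\<in>{m..<n}. (cmod (c n))\<^sup>2) < e"
      using *[rule_format, of "sqrt e"] by (simp add: small)
  next
    fix e :: real assume *: "\<forall>e>0. \<exists>N. \<forall>m\<ge>N. \<forall>n. norm (\<Sum>n\<in>{m..<n}. (cmod (c n))\<^sup>2) < e" and "0 < e"
    then show "\<exists>N. \<forall>m\<ge>N. \<forall>n. norm (\<Sum>n\<in>{m..<n}. c n *\<^sub>C walsh_L2 n) < e"
      using *[rule_format, of "e\<^sup>2"] by (simp add: small)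
  qed
qed

lemma walsh_coeff_suminf:
  assumes "summable (\<lambda>n. c n *\<^sub>C walsh_L2 n)"
  shows "walsh_coeff (\<Sum>n. c n *\<^sub>C walsh_L2 n) m = c m"
proof -
  have "(\<lambda>n. walsh_coeff (c n *\<^sub>C walsh_L2 n) m) sums walsh_coeff (\<Sum>n. c n *\<^sub>C walsh_L2 n) m"
    by (rule bounded_linear.sums[OF bounded_linear_walsh_coeff summable_sums[OF assms]])
  moreover have "(\<lambda>n. walsh_coeff (c n *\<^sub>C walsh_L2 n) m) = (\<lambda>n. if n = m then c n else 0)"
    by (auto simp: walsh_coeff_scaleC walsh_coeff_walsh)
  ultimately show ?thesis
    using sums_unique2 sums_If_finite_set[of "{m}" c] by fastforce
qed

text \<open>
  Bessel's inequality makes the Walsh series of \<open>f\<close> converge. Its sum has the same coefficients as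
  \<open>f\<close>, hence equals \<open>f\<close>, and the norms of the partial sums converge to the norm of \<open>f\<close>.
\<close>

lemma Parseval_walsh: "(\<lambda>n. (cmod (walsh_coeff f n))\<^sup>2) sums (norm f)\<^sup>2"
proof -
  define P where "P N = (\<Sum>n<N. walsh_coeff f n *\<^sub>C walsh_L2 n)" for N
  have norm_P: "(norm (P N))\<^sup>2 = (\<Sum>n<N. (cmod (walsh_coeff f n))\<^sup>2)" for N
    by (simp add: P_def norm_walsh_polynomial)
  have "f \<bullet> P N = (norm (P N))\<^sup>2" for N
    unfolding norm_P unfolding P_def inner_sum_right
    by (simp add: inner_scaleC_walsh cmod_power2 flip: power2_eq_square)
  then have "(norm (P N))\<^sup>2 \<le> norm f * norm (P N)" for N
    using norm_cauchy_schwarz[of f "P N"] by simp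
  then have "norm (P N) \<le> norm f" for N
    by (cases "P N = 0") (auto simp: power2_eq_square intro: mult_right_le_imp_le[of _ "norm (P N)"])
  then have "(\<Sum>n<N. (cmod (walsh_coeff f n))\<^sup>2) \<le> (norm f)\<^sup>2" for N
    unfolding norm_P[symmetric] by (intro power_mono) auto
  then have "summable (\<lambda>n. (cmod (walsh_coeff f n))\<^sup>2)"
    by (intro summableI_nonneg_bounded) auto
  then have sum: "summable (\<lambda>n. walsh_coeff f n *\<^sub>C walsh_L2 n)"
    by (simp add: Riesz_Fischer_walsh)
  have "f = (\<Sum>n. walsh_coeff f n *\<^sub>C walsh_L2 n)"
    by (rule walsh_coeff_inject) (simp add: walsh_coeff_suminf sum)
  then have "P \<longlonglongrightarrow> f"
    using summable_LIMSEQ[OF sum] by (simp add: P_def[abs_def])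
  then have "(\<lambda>N. (norm (P N))\<^sup>2) \<longlonglongrightarrow> (norm f)\<^sup>2"
    by (intro tendsto_intros)
  then show ?thesis
    by (simp add: norm_P sums_def)
qed

section \<open>The spectrum of a Walsh multiplier\<close>

lemma walsh_coeff_multiplier:
  assumes "bounded_walsh_multiplier a"
  shows "walsh_coeff (walsh_multiplier a f) n = a n * walsh_coeff f n"
  using assms unfolding walsh_multiplier_def bounded_walsh_multiplier_def
  by (intro walsh_coeff_suminf) auto

text \<open>
  Multiplication by a bounded sequence preserves square summability, so the series converges by
  Riesz-Fischer, and Parseval's identity yields the norm bound.
\<close>

lemma bounded_walsh_multiplier_of_bounded_symbol:
  assumes b: "\<And>n. cmod (b n) \<le> B"
  shows "bounded_walsh_multiplier b"
    and "norm (walsh_multiplier b f) \<le> B * norm f"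
proof -
  have B: "0 \<le> B"
    using b[of 0] norm_ge_zero order_trans by blast
  have le: "(cmod (b n * walsh_coeff f n))\<^sup>2 \<le> B\<^sup>2 * (cmod (walsh_coeff f n))\<^sup>2" for f n
    using b[of n] by (auto simp: norm_mult power_mult_distrib intro!: mult_right_mono power_mono)
  have sum: "summable (\<lambda>n. (b n * walsh_coeff f n) *\<^sub>C walsh_L2 n)" for f
    unfolding Riesz_Fischer_walsh
    by (rule summable_comparison_test'[OF summable_mult[OF sums_summable[OF Parseval_walsh]]])
      (use le in auto)
  have coeff: "walsh_coeff (walsh_multiplier b f) n = b n * walsh_coeff f n" for f n
    unfolding walsh_multiplier_def by (intro walsh_coeff_suminf sum)
  have bound: "norm (walsh_multiplier b f) \<le> B * norm f" for f
  proof -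
    have "(norm (walsh_multiplier b f))\<^sup>2 \<le> B\<^sup>2 * (norm f)\<^sup>2"
      using sums_le[OF le[of _ f] Parseval_walsh[of "walsh_multiplier b f", unfolded coeff]
          sums_mult[OF Parseval_walsh]] .
    then have "(norm (walsh_multiplier b f))\<^sup>2 \<le> (B * norm f)\<^sup>2"
      by (simp add: power_mult_distrib)
    then show ?thesis
      by (rule power2_le_imp_le) (simp add: B)
  qed
  show "norm (walsh_multiplier b f) \<le> B * norm f"
    by (rule bound)
  have scale: "walsh_multiplier b (c *\<^sub>C f) = c *\<^sub>C walsh_multiplier b f" for c f
    by (rule walsh_coeff_inject) (simp add: coeff walsh_coeff_scaleC)
  have "bounded_linear (walsh_multiplier b)"
  proof (rule bounded_linear_intro)
    show "walsh_multiplier b (f + g) = walsh_multiplier b f + walsh_multiplier b g" for f g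
      by (rule walsh_coeff_inject) (simp add: coeff walsh_coeff_add distrib_left)
    show "walsh_multiplier b (r *\<^sub>R f) = r *\<^sub>R walsh_multiplier b f" for r f
      by (simp add: scaleR_eq_scaleC scale)
    show "norm (walsh_multiplier b f) \<le> norm f * B" for f
      using bound[of f] by (simp add: mult.commute)
  qed
  then show "bounded_walsh_multiplier b"
    using sum scale by (auto simp: bounded_walsh_multiplier_def bounded_clinear_def)
qed

lemma walsh_multiplier_walsh:
  assumes "bounded_walsh_multiplier a"
  shows "walsh_multiplier a (walsh_L2 n) = a n *\<^sub>C walsh_L2 n"
  by (rule walsh_coeff_inject)
    (simp add: walsh_coeff_multiplier[OF assms] walsh_coeff_scaleC walsh_coeff_walsh)

lemma resolvent_walsh_multiplier:
  assumes a: "bounded_walsh_multiplier a" and B: "\<And>n. B \<le> cmod (a n - z)" "0 < B"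
  defines "b \<equiv> \<lambda>n. 1 / (a n - z)"
  shows "bounded_walsh_multiplier b"
    and "walsh_multiplier b (walsh_multiplier a f - z *\<^sub>C f) = f"
    and "walsh_multiplier a (walsh_multiplier b f) - z *\<^sub>C walsh_multiplier b f = f"
proof -
  have "cmod (b n) \<le> 1 / B" for n
    using B(1)[of n] B(2) by (simp add: b_def norm_divide frac_le)
  then show b: "bounded_walsh_multiplier b"
    by (rule bounded_walsh_multiplier_of_bounded_symbol)
  have nz: "a n - z \<noteq> 0" for n
    using B(1)[of n] B(2) by auto
  show "walsh_multiplier b (walsh_multiplier a f - z *\<^sub>C f) = f"
  proof (rule walsh_coeff_inject)
    fix n
    have "walsh_coeff (walsh_multiplier b (walsh_multiplier a f - z *\<^sub>C f)) n
        = b n * ((a n - z) * walsh_coeff f n)"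
      by (simp add: walsh_coeff_multiplier a b walsh_coeff_diff walsh_coeff_scaleC left_diff_distrib)
    then show "walsh_coeff (walsh_multiplier b (walsh_multiplier a f - z *\<^sub>C f)) n = walsh_coeff f n"
      using nz[of n] by (simp add: b_def)
  qed
  show "walsh_multiplier a (walsh_multiplier b f) - z *\<^sub>C walsh_multiplier b f = f"
  proof (rule walsh_coeff_inject)
    fix n
    have "walsh_coeff (walsh_multiplier a (walsh_multiplier b f) - z *\<^sub>C walsh_multiplier b f) n
        = (a n - z) * (b n * walsh_coeff f n)"
      by (simp add: walsh_coeff_multiplier a b walsh_coeff_diff walsh_coeff_scaleC left_diff_distrib)
    then show "walsh_coeff (walsh_multiplier a (walsh_multiplier b f) - z *\<^sub>C walsh_multiplier b f) n
        = walsh_coeff f n"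
      using nz[of n] by (simp add: b_def)
  qed
qed

text \<open>
  The upper bound is the estimate by the supremum of the symbol; the lower bound comes from testing on
  the unit vectors \<open>walsh_L2 n\<close>, which are eigenvectors.
\<close>

lemma onorm_walsh_multiplier:
  assumes b: "\<And>n. cmod (b n) \<le> B"
  shows "onorm (walsh_multiplier b) = (SUP n. cmod (b n))"
proof (rule antisym)
  have bdd: "bdd_above (range (\<lambda>n. cmod (b n)))"
    using b by (rule bdd_aboveI2)
  have mult: "bounded_walsh_multiplier b"
    using b by (rule bounded_walsh_multiplier_of_bounded_symbol)
  show "onorm (walsh_multiplier b) \<le> (SUP n. cmod (b n))"
  proof (rule onorm_bound)
    show "0 \<le> (SUP n. cmod (b n))"
      using cSUP_upper[OF UNIV_I bdd, of 0] norm_ge_zero order_trans by blast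
    show "norm (walsh_multiplier b f) \<le> (SUP n. cmod (b n)) * norm f" for f
      by (rule bounded_walsh_multiplier_of_bounded_symbol) (intro cSUP_upper bdd UNIV_I)
  qed
  have lin: "bounded_linear (walsh_multiplier b)"
    using mult by (simp add: bounded_walsh_multiplier_def bounded_clinear_def)
  show "(SUP n. cmod (b n)) \<le> onorm (walsh_multiplier b)"
  proof (rule cSUP_least)
    show "cmod (b n) \<le> onorm (walsh_multiplier b)" for n
      using onorm[OF lin, of "walsh_L2 n"] by (simp add: walsh_multiplier_walsh[OF mult] norm_scaleC)
  qed simp
qed

text \<open>
  A bounded inverse \<open>S\<close> sends \<open>(a n - z) *\<^sub>C walsh_L2 n\<close> to the unit vector \<open>walsh_L2 n\<close>, so
  \<open>\<bar>a n - z\<bar>\<close> cannot drop below the reciprocal of a bound for \<open>S\<close>.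
\<close>

lemma resolvent_set_walsh_multiplier_lower_bound:
  assumes a: "bounded_walsh_multiplier a" and z: "z \<in> resolvent_set (walsh_multiplier a)"
  shows "\<exists>B>0. \<forall>n. B \<le> cmod (a n - z)"
proof -
  obtain S where S: "bounded_clinear S" "\<And>f. S (walsh_multiplier a f - z *\<^sub>C f) = f"
    using z by (auto simp: resolvent_set_def)
  from S(1) obtain K where K: "0 < K" "\<And>f. norm (S f) \<le> norm f * K"
    using bounded_linear.pos_bounded by (meson bounded_clinear_def)
  have "1 / K \<le> cmod (a n - z)" for n
  proof -
    have "walsh_multiplier a (walsh_L2 n) - z *\<^sub>C walsh_L2 n = (a n - z) *\<^sub>C walsh_L2 n"
      by (rule walsh_coeff_inject)
        (simp add: walsh_multiplier_walsh[OF a] walsh_coeff_diff walsh_coeff_scaleC left_diff_distrib)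
    then have "1 \<le> cmod (a n - z) * K"
      using K(2)[of "(a n - z) *\<^sub>C walsh_L2 n"] S(2)[of "walsh_L2 n"] by (simp add: norm_scaleC)
    then show ?thesis
      using K(1) by (simp add: divide_le_eq)
  qed
  then show ?thesis
    using K(1) by (intro exI[of _ "1 / K"]) auto
qed

lemma resolvent_set_walsh_multiplier_iff:
  assumes a: "bounded_walsh_multiplier a"
  shows "z \<in> resolvent_set (walsh_multiplier a) \<longleftrightarrow> (\<exists>B>0. \<forall>n. B \<le> cmod (a n - z))"
proof
  assume "\<exists>B>0. \<forall>n. B \<le> cmod (a n - z)"
  then obtain B where B: "\<And>n. B \<le> cmod (a n - z)" "0 < B"
    by auto
  show "z \<in> resolvent_set (walsh_multiplier a)"
    using resolvent_walsh_multiplier[OF a B]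
    by (auto simp: resolvent_set_def bounded_walsh_multiplier_def)
qed (rule resolvent_set_walsh_multiplier_lower_bound[OF a])

theorem theorem4p2:
  fixes a :: "nat \<Rightarrow> complex"
  assumes "bounded_walsh_multiplier a"
  shows "spectrum (walsh_multiplier a) = closure (range a) \<and>
    (\<forall>z. z \<in> resolvent_set (walsh_multiplier a) \<longleftrightarrow> (INF n. cmod (a n - z)) > 0) \<and>
    (\<forall>z \<in> resolvent_set (walsh_multiplier a).
       onorm (inv (\<lambda>f. walsh_multiplier a f - z *\<^sub>C f)) = (SUP n. 1 / cmod (a n - z)))"
proof (intro conjI allI ballI)
  note resolvent = resolvent_set_walsh_multiplier_iff[OF assms]
  have "z \<in> spectrum (walsh_multiplier a) \<longleftrightarrow> z \<in> closure (range a)" for z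
    unfolding spectrum_def Compl_iff resolvent closure_approachable
    by (auto simp: dist_norm not_le)
  then show "spectrum (walsh_multiplier a) = closure (range a)"
    by blast
  show "z \<in> resolvent_set (walsh_multiplier a) \<longleftrightarrow> (INF n. cmod (a n - z)) > 0" for z
  proof -
    have "bdd_below (range (\<lambda>n. cmod (a n - z)))"
      by (rule bdd_belowI[of _ 0]) auto
    then have "(INF n. cmod (a n - z)) \<le> cmod (a n - z)" for n
      by (rule cINF_lower) simp
    moreover have "B \<le> (INF n. cmod (a n - z))" if "\<forall>n. B \<le> cmod (a n - z)" for B
      using that by (intro cINF_greatest) auto
    ultimately show ?thesis
      unfolding resolvent by (meson less_le_trans)
  qed
  fix z assume "z \<in> resolvent_set (walsh_multiplier a)"
  then obtain B where B: "\<And>n. B \<le> cmod (a n - z)" "0 < B"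
    unfolding resolvent by auto
  note inverse = resolvent_walsh_multiplier[OF assms B]
  have "inv (\<lambda>f. walsh_multiplier a f - z *\<^sub>C f) = walsh_multiplier (\<lambda>n. 1 / (a n - z))"
    by (rule inv_unique_comp) (auto simp: fun_eq_iff inverse)
  moreover have "cmod (1 / (a n - z)) \<le> 1 / B" for n
    using B(1)[of n] B(2) by (simp add: norm_divide frac_le)
  then have "onorm (walsh_multiplier (\<lambda>n. 1 / (a n - z))) = (SUP n. cmod (1 / (a n - z)))"
    by (rule onorm_walsh_multiplier)
  ultimately show "onorm (inv (\<lambda>f. walsh_multiplier a f - z *\<^sub>C f)) = (SUP n. 1 / cmod (a n - z))"
    by (simp add: norm_divide)
qed

end
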